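(* Let $(\mathcal{G}_1,e_1,f_1)$ and $(\mathcal{G}_2,e_2,f_2)$ be birooted graphs with vertex sets $V_1,V_2$ and adjacency matrices $a_1,a_2$, respectively. The adjacency matrix of $\mathcal{G}=\mathcal{G}_1\vartriangleright_{f_2}\mathcal{G}_2$ has a decomposition $$a(\mathcal{G})=S_1+S_2,$$ where $$S_1=a_1\otimes P_{e_2}\otimes P_{f_2},\qquad S_2=P_{e_1}\otimes a_2\otimes 1_2+P_{e_1}^{\perp}\otimes 1_2\otimes a_2$$ act on the Hilbert space $\mathcal{H}=\ell^2(V_1\vartriangleright_{f_2}V_2)\subset\ell^2(V_1)\otimes\ell^2(V_2)\otimes\ell^2(V_2)$, with the root $e$ identified with $e_1\otimes e_2\otimes f_2$.
   Context: Graphs are non-oriented, uniformly locally finite (vertex degrees uniformly bounded), possibly disconnected with finitely many components, and may have loops. A birooted graph $(\mathcal{G},e,f)$ is a graph with two distinguished vertices $e,f$ (roots; allowed to coincide). The adjacency matrix $a(\mathcal{G})$ acts on $\ell^2(V)$ and its $(x,y)$ entry is the number of edges joining $x$ and $y$ (each loop counted once). For a vertex $x$, $\delta(x)\in\ell^2(V)$ is the associated unit basis vector (also written just $x$), $P_x$ is the orthogonal projection onto $\mathbb{C}\delta(x)$ and $P_x^{\perp}=1-P_x$; $1_i$ is the identity on $\ell^2(V_i)$. The graph $\mathcal{G}_1\vartriangleright_{f_2}\mathcal{G}_2=(\mathcal{G}_1,e_1)\vartriangleright_{f_2}(\mathcal{G}_2,e_2)$ is the rooted graph obtained by attaching (gluing)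 a copy of $\mathcal{G}_2$ by its vertex $e_2$ to the root $e_1$ of $\mathcal{G}_1$, and a copy of $\mathcal{G}_2$ by its vertex $f_2$ to each of the remaining vertices of $\mathcal{G}_1$; all edges of $\mathcal{G}_1$ and of all copies of $\mathcal{G}_2$ are kept; the root $e$ is the vertex obtained by identifying $e_1$ with $e_2$ in the copy attached there. Its vertex set $V_1\vartriangleright_{f_2}V_2$ is identified with the subset $$\{(e_1,y,f_2):y\in V_2\}\cup\{(x,e_2,y):x\in V_1\setminus\{e_1\},\,y\in V_2\}$$ of $V_1\times V_2\times V_2$: $(e_1,y,f_2)$ is the vertex $y$ of the copy of $\mathcal{G}_2$ attached at $e_1$, and $(x,e_2,y)$ is the vertex $y$ of the copy attached at $x\neq e_1$. Thus the vertex $x$ of $\mathcal{G}_1$ corresponds to $(x,e_2,f_2)$, and $e=(e_1,e_2,f_2)$. *)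

theory Defs
  imports "HOL-Analysis.Analysis" "HOL-Library.Function_Algebras"
begin

section \<open>Non-oriented graphs with loops and multiple edges\<close>

record ('v, 'e) ugraph =
  verts :: "'v set"
  edges :: "'e set"
  ends :: "'e \<Rightarrow> 'v set"

text \<open>A loop at \<open>x\<close> is an edge with \<open>ends \<epsilon> = {x, x}\<close>.\<close>

definition wf_ugraph :: "('v, 'e) ugraph \<Rightarrow> bool" where
  "wf_ugraph G \<longleftrightarrow> (\<forall>\<epsilon>\<in>edges G. \<exists>x\<in>verts G. \<exists>y\<in>verts G. ends G \<epsilon> = {x, y})"

definition uniformly_locally_finite :: "('v, 'e) ugraph \<Rightarrow> bool" where
  "uniformly_locally_finite G \<longleftrightarrow>
     (\<exists>d. \<forall>x\<in>verts G. finite {\<epsilon>\<in>edges G. x \<in> ends G \<epsilon>} \<and> card {\<epsilon>\<in>edges G. x \<in> ends G \<epsilon>} \<le> d)"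

definition connected_in :: "('v, 'e) ugraph \<Rightarrow> ('v \<times> 'v) set" where
  "connected_in G = {(x, y). x \<in> verts G \<and> y \<in> verts G \<and>
     (x, y) \<in> {(u, v). \<exists>\<epsilon>\<in>edges G. ends G \<epsilon> = {u, v}}\<^sup>*}"

definition graph_components :: "('v, 'e) ugraph \<Rightarrow> 'v set set" where
  "graph_components G = verts G // connected_in G"

definition birooted_graph :: "('v, 'e) ugraph \<Rightarrow> 'v \<Rightarrow> 'v \<Rightarrow> bool" where
  "birooted_graph G e f \<longleftrightarrow> wf_ugraph G \<and> uniformly_locally_finite G \<and>
     finite (graph_components G) \<and> e \<in> verts G \<and> f \<in> verts G"

definition adjacency :: "('v, 'e) ugraph \<Rightarrow> 'v \<Rightarrow> 'v \<Rightarrow> nat" where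
  "adjacency G x y = card {\<epsilon>\<in>edges G. ends G \<epsilon> = {x, y}}"


section \<open>Gluing\<close>

text \<open>\<open>copy_vertex e1 e2 f2 x y\<close> is the vertex \<open>y\<close> of the copy of the second graph attached at the
  vertex \<open>x\<close> of the first one; \<open>anchor e1 e2 f2 x\<close> is the vertex by which this copy is attached.
  Since every \<open>x\<close> is identified with the anchor of its copy, the vertices of the copies
  already exhaust the glued graph.\<close>

definition copy_vertex :: "'v \<Rightarrow> 'w \<Rightarrow> 'w \<Rightarrow> 'v \<Rightarrow> 'w \<Rightarrow> 'v \<times> 'w \<times> 'w" where
  "copy_vertex e1 e2 f2 x y = (if x = e1 then (e1, y, f2) else (x, e2, y))"

definition anchor :: "'v \<Rightarrow> 'w \<Rightarrow> 'w \<Rightarrow> 'v \<Rightarrow> 'w" where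
  "anchor e1 e2 f2 x = (if x = e1 then e2 else f2)"

definition base_vertex :: "'v \<Rightarrow> 'w \<Rightarrow> 'w \<Rightarrow> 'v \<Rightarrow> 'v \<times> 'w \<times> 'w" where
  "base_vertex e1 e2 f2 x = copy_vertex e1 e2 f2 x (anchor e1 e2 f2 x)"

text \<open>\<open>Inl \<epsilon>\<close> is an edge of the first graph, \<open>Inr (x, \<epsilon>)\<close> the edge \<open>\<epsilon>\<close> of the copy of
  the second graph attached at \<open>x\<close>.\<close>

definition glue ::
  "('v, 'a) ugraph \<Rightarrow> 'v \<Rightarrow> ('w, 'b) ugraph \<Rightarrow> 'w \<Rightarrow> 'w \<Rightarrow> ('v \<times> 'w \<times> 'w, 'a + 'v \<times> 'b) ugraph" where
  "glue G1 e1 G2 e2 f2 =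
     \<lparr>verts = {(e1, y, f2) | y. y \<in> verts G2} \<union>
              {(x, e2, y) | x y. x \<in> verts G1 - {e1} \<and> y \<in> verts G2},
      edges = edges G1 <+> (verts G1 \<times> edges G2),
      ends = case_sum (\<lambda>\<epsilon>. base_vertex e1 e2 f2 ` ends G1 \<epsilon>)
                      (\<lambda>(x, \<epsilon>). copy_vertex e1 e2 f2 x ` ends G2 \<epsilon>)\<rparr>"

text \<open>The root \<open>e\<close> of the glued graph: \<open>e1\<close>, identified with \<open>e2\<close> in the copy attached there.\<close>

definition glue_root :: "'v \<Rightarrow> 'w \<Rightarrow> 'w \<Rightarrow> 'v \<times> 'w \<times> 'w" where
  "glue_root e1 e2 f2 = base_vertex e1 e2 f2 e1"

lemma base_vertex_eq: "base_vertex e1 e2 f2 x = (x, e2, f2)"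
  by (simp add: base_vertex_def copy_vertex_def anchor_def)

lemma wf_glue:
  assumes "wf_ugraph G1" "wf_ugraph G2" "e1 \<in> verts G1" "e2 \<in> verts G2" "f2 \<in> verts G2"
  shows "wf_ugraph (glue G1 e1 G2 e2 f2)"
  unfolding wf_ugraph_def
proof
  let ?G = "glue G1 e1 G2 e2 f2"
  have c: "copy_vertex e1 e2 f2 x y \<in> verts ?G" if "x \<in> verts G1" "y \<in> verts G2" for x y
    using that by (auto simp: glue_def copy_vertex_def)
  have b: "base_vertex e1 e2 f2 x \<in> verts ?G" if "x \<in> verts G1" for x
    using that assms by (auto simp: base_vertex_def anchor_def intro: c)
  fix \<epsilon> assume "\<epsilon> \<in> edges ?G"
  then consider a where "\<epsilon> = Inl a" "a \<in> edges G1"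
    | x a where "\<epsilon> = Inr (x, a)" "x \<in> verts G1" "a \<in> edges G2"
    by (auto simp: glue_def)
  then show "\<exists>x\<in>verts ?G. \<exists>y\<in>verts ?G. ends ?G \<epsilon> = {x, y}"
  proof cases
    case 1
    then obtain u v where "u \<in> verts G1" "v \<in> verts G1" "ends G1 a = {u, v}"
      using assms by (auto simp: wf_ugraph_def)
    then show ?thesis using 1 b[of u] b[of v]
      by (intro bexI[of _ "base_vertex e1 e2 f2 u"] bexI[of _ "base_vertex e1 e2 f2 v"])
        (auto simp: glue_def)
  next
    case 2
    then obtain u v where "u \<in> verts G2" "v \<in> verts G2" "ends G2 a = {u, v}"
      using assms by (auto simp: wf_ugraph_def)
    then show ?thesis using 2 c[of x u] c[of x v]
      by (intro bexI[of _ "copy_vertex e1 e2 f2 x u"] bexI[of _ "copy_vertex e1 e2 f2 x v"])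
        (auto simp: glue_def)
  qed
qed


section \<open>The Hilbert spaces and their operators\<close>

text \<open>Vectors of \<open>\<ell>\<^sup>2(X)\<close> are functions on the ambient type vanishing outside \<open>X\<close>, so that
  \<open>\<ell>\<^sup>2(X)\<close> is literally a subspace of \<open>\<ell>\<^sup>2(Y)\<close> for \<open>X \<subseteq> Y\<close>.\<close>

type_synonym 'v op = "('v \<Rightarrow> complex) \<Rightarrow> ('v \<Rightarrow> complex)"

definition ell2 :: "'v set \<Rightarrow> ('v \<Rightarrow> complex) set" where
  "ell2 X = {\<xi>. (\<forall>x. x \<notin> X \<longrightarrow> \<xi> x = 0) \<and> (\<lambda>x. (cmod (\<xi> x))\<^sup>2) summable_on UNIV}"

definition ell2_inner :: "('v \<Rightarrow> complex) \<Rightarrow> ('v \<Rightarrow> complex) \<Rightarrow> complex" where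
  "ell2_inner \<xi> \<eta> = (\<Sum>\<^sub>\<infinity>x. cnj (\<xi> x) * \<eta> x)"

definition ell2_norm :: "('v \<Rightarrow> complex) \<Rightarrow> real" where
  "ell2_norm \<xi> = sqrt (\<Sum>\<^sub>\<infinity>x. (cmod (\<xi> x))\<^sup>2)"

definition bounded_op :: "'v set \<Rightarrow> 'v op \<Rightarrow> bool" where
  "bounded_op X T \<longleftrightarrow>
     (\<forall>\<xi>\<in>ell2 X. T \<xi> \<in> ell2 X) \<and>
     (\<forall>\<xi>\<in>ell2 X. \<forall>\<eta>\<in>ell2 X. T (\<lambda>x. \<xi> x + \<eta> x) = (\<lambda>x. T \<xi> x + T \<eta> x)) \<and>
     (\<forall>\<xi>\<in>ell2 X. \<forall>c. T (\<lambda>x. c * \<xi> x) = (\<lambda>x. c * T \<xi> x)) \<and>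
     (\<exists>K\<ge>0. \<forall>\<xi>\<in>ell2 X. ell2_norm (T \<xi>) \<le> K * ell2_norm \<xi>)"

definition delta :: "'v \<Rightarrow> 'v \<Rightarrow> complex" where
  "delta x = (\<lambda>y. if y = x then 1 else 0)"

definition vertex_proj :: "'v \<Rightarrow> 'v op" where
  "vertex_proj x = (\<lambda>\<xi> y. ell2_inner (delta x) \<xi> * delta x y)"

definition adj_op :: "('v, 'e) ugraph \<Rightarrow> 'v op" where
  "adj_op G = (\<lambda>\<xi> x. \<Sum>\<^sub>\<infinity>y\<in>verts G. of_nat (adjacency G x y) * \<xi> y)"

text \<open>\<open>\<ell>\<^sup>2(X) \<otimes> \<ell>\<^sup>2(Y)\<close> is realised as \<open>\<ell>\<^sup>2(X \<times> Y)\<close>, with \<open>\<xi> \<otimes> \<eta>\<close> the product function.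
  The operator \<open>A \<otimes> B\<close> is \<open>(A \<otimes> 1)(1 \<otimes> B)\<close>, each factor acting on one coordinate; the lemmas below
  show that it is the bounded operator sending \<open>\<xi> \<otimes> \<eta>\<close> to \<open>A \<xi> \<otimes> B \<eta>\<close>. Triple tensor products are
  nested to the right, as are triples.\<close>

definition tensor_vec ::
  "('v \<Rightarrow> complex) \<Rightarrow> ('w \<Rightarrow> complex) \<Rightarrow> ('v \<times> 'w \<Rightarrow> complex)" (infixr \<open>\<otimes>\<^sub>v\<close> 75) where
  "\<xi> \<otimes>\<^sub>v \<eta> = (\<lambda>(x, y). \<xi> x * \<eta> y)"

definition tensor_op :: "'v op \<Rightarrow> 'w op \<Rightarrow> ('v \<times> 'w) op" (infixr \<open>\<otimes>\<^sub>o\<close> 75) where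
  "A \<otimes>\<^sub>o B = (\<lambda>u (x, y). A (\<lambda>x'. B (\<lambda>y'. u (x', y')) y) x)"

lemma vertex_proj_apply: "vertex_proj x \<xi> = (\<lambda>y. if y = x then \<xi> x else 0)"
proof -
  have "(\<Sum>\<^sub>\<infinity>z. cnj (delta x z) * \<xi> z) = (\<Sum>\<^sub>\<infinity>z\<in>{x}. cnj (delta x z) * \<xi> z)"
    by (rule infsum_cong_neutral) (auto simp: delta_def)
  then show ?thesis
    by (auto simp: vertex_proj_def ell2_inner_def delta_def)
qed

lemma tensor_op_tensor_vec:
  assumes "bounded_op X A" "bounded_op Y B" "\<xi> \<in> ell2 X" "\<eta> \<in> ell2 Y"
  shows "(A \<otimes>\<^sub>o B) (\<xi> \<otimes>\<^sub>v \<eta>) = A \<xi> \<otimes>\<^sub>v B \<eta>"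
proof -
  have B: "B (\<lambda>y. c * \<eta> y) = (\<lambda>y. c * B \<eta> y)" for c
    using assms by (auto simp: bounded_op_def)
  have A: "A (\<lambda>x. c * \<xi> x) = (\<lambda>x. c * A \<xi> x)" for c
    using assms by (auto simp: bounded_op_def)
  show ?thesis
    using A by (simp add: tensor_op_def tensor_vec_def B fun_eq_iff mult.commute[of _ "B \<eta> _"])
qed

lemma bounded_op_comp:
  assumes "bounded_op X S" "bounded_op X T"
  shows "bounded_op X (\<lambda>\<xi>. S (T \<xi>))"
proof -
  obtain K L where K: "K \<ge> 0" "\<forall>\<xi>\<in>ell2 X. ell2_norm (S \<xi>) \<le> K * ell2_norm \<xi>"
    and L: "L \<ge> 0" "\<forall>\<xi>\<in>ell2 X. ell2_norm (T \<xi>) \<le> L * ell2_norm \<xi>"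
    using assms by (auto simp: bounded_op_def)
  have T: "T \<xi> \<in> ell2 X" if "\<xi> \<in> ell2 X" for \<xi>
    using assms that by (auto simp: bounded_op_def)
  have "ell2_norm (S (T \<xi>)) \<le> (K * L) * ell2_norm \<xi>" if "\<xi> \<in> ell2 X" for \<xi>
  proof -
    have "ell2_norm (S (T \<xi>)) \<le> K * ell2_norm (T \<xi>)" using K T that by blast
    also have "\<dots> \<le> K * (L * ell2_norm \<xi>)" using K L that by (intro mult_left_mono) auto
    finally show ?thesis by simp
  qed
  moreover have "K * L \<ge> 0" using K L by simp
  ultimately have "\<exists>M\<ge>0. \<forall>\<xi>\<in>ell2 X. ell2_norm (S (T \<xi>)) \<le> M * ell2_norm \<xi>" by blast
  then show ?thesis using assms unfolding bounded_op_def by simp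
qed

lemma bounded_op_leg:
  fixes X :: "'a set" and Y :: "'b set"
  assumes "bounded_op Y B"
  shows "bounded_op (X \<times> Y) (\<lambda>u (x, y). B (\<lambda>y'. u (x, y')) y)"
proof -
  obtain K where K: "K \<ge> 0" "\<forall>\<xi>\<in>ell2 Y. ell2_norm (B \<xi>) \<le> K * ell2_norm \<xi>"
    using assms by (auto simp: bounded_op_def)
  have add: "B (\<lambda>x. \<xi> x + \<eta> x) = (\<lambda>x. B \<xi> x + B \<eta> x)" if "\<xi> \<in> ell2 Y" "\<eta> \<in> ell2 Y" for \<xi> \<eta>
    using assms that by (auto simp: bounded_op_def)
  have scale: "B (\<lambda>x. c * \<xi> x) = (\<lambda>x. c * B \<xi> x)" if "\<xi> \<in> ell2 Y" for c \<xi>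
    using assms that by (auto simp: bounded_op_def)
  have B: "B \<xi> \<in> ell2 Y" if "\<xi> \<in> ell2 Y" for \<xi>
    using assms that by (auto simp: bounded_op_def)
  have slice: "(\<lambda>y. u (x, y)) \<in> ell2 Y" if "u \<in> ell2 (X \<times> Y)" for u :: "'a \<times> 'b \<Rightarrow> complex" and x
  proof -
    have "(\<lambda>(x, y). (cmod (u (x, y)))\<^sup>2) summable_on (UNIV \<times> UNIV)"
      using that by (simp add: ell2_def case_prod_unfold)
    from summable_on_SigmaD1[OF this, of x] that show ?thesis by (simp add: ell2_def)
  qed
  have main: "(\<lambda>(x, y). B (\<lambda>y'. u (x, y')) y) \<in> ell2 (X \<times> Y) \<and>
      ell2_norm (\<lambda>(x, y). B (\<lambda>y'. u (x, y')) y) \<le> K * ell2_norm u"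
    if u: "u \<in> ell2 (X \<times> Y)" for u :: "'a \<times> 'b \<Rightarrow> complex"
  proof -
    define f where "f p = (cmod (u p))\<^sup>2" for p
    define w where "w = (\<lambda>(x, y). B (\<lambda>y'. u (x, y')) y)"
    define h where "h p = (cmod (w p))\<^sup>2" for p
    have fs: "f summable_on (UNIV \<times> UNIV)" using u by (simp add: ell2_def f_def[abs_def])
    have fsl: "(\<lambda>y. f (x, y)) summable_on UNIV" for x
      using slice[OF u, of x] by (simp add: ell2_def f_def)
    have hsl: "(\<lambda>y. h (x, y)) summable_on UNIV" for x
      using B[OF slice[OF u, of x]] by (simp add: ell2_def h_def w_def)
    have le: "(\<Sum>\<^sub>\<infinity>y. h (x, y)) \<le> K\<^sup>2 * (\<Sum>\<^sub>\<infinity>y. f (x, y))" for x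
    proof -
      have 1: "ell2_norm (B (\<lambda>y. u (x, y))) \<le> K * ell2_norm (\<lambda>y. u (x, y))"
        using K slice[OF u] by blast
      have nn: "0 \<le> (\<Sum>\<^sub>\<infinity>y. h (x, y))" "0 \<le> (\<Sum>\<^sub>\<infinity>y. f (x, y))"
        by (auto intro!: infsum_nonneg simp: h_def f_def)
      have "sqrt (\<Sum>\<^sub>\<infinity>y. h (x, y)) \<le> K * sqrt (\<Sum>\<^sub>\<infinity>y. f (x, y))"
        using 1 by (simp add: ell2_norm_def h_def f_def w_def)
      then have "(sqrt (\<Sum>\<^sub>\<infinity>y. h (x, y)))\<^sup>2 \<le> (K * sqrt (\<Sum>\<^sub>\<infinity>y. f (x, y)))\<^sup>2"
        using nn by (intro power_mono) auto
      then show ?thesis using nn by (simp add: power_mult_distrib)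
    qed
    have Fs: "(\<lambda>x. \<Sum>\<^sub>\<infinity>y. f (x, y)) summable_on UNIV"
      using summable_on_SigmaD[OF fs] fsl by simp
    then have KFs: "(\<lambda>x. K\<^sup>2 * (\<Sum>\<^sub>\<infinity>y. f (x, y))) summable_on UNIV"
      by (rule summable_on_cmult_right)
    have Hs: "(\<lambda>x. \<Sum>\<^sub>\<infinity>y. h (x, y)) summable_on UNIV"
      by (rule summable_on_comparison_test[OF KFs le]) (auto intro!: infsum_nonneg simp: h_def)
    have hs: "h summable_on (UNIV \<times> UNIV)"
      by (rule summable_on_SigmaI[OF _ Hs]) (use hsl in \<open>auto simp: h_def\<close>)
    have "infsum h (UNIV \<times> UNIV) = (\<Sum>\<^sub>\<infinity>x. \<Sum>\<^sub>\<infinity>y. h (x, y))"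
      using infsum_Sigma_banach[OF hs] by simp
    also have "\<dots> \<le> (\<Sum>\<^sub>\<infinity>x. K\<^sup>2 * (\<Sum>\<^sub>\<infinity>y. f (x, y)))"
      by (rule infsum_mono[OF Hs KFs]) (rule le)
    also have "\<dots> = K\<^sup>2 * (\<Sum>\<^sub>\<infinity>x. \<Sum>\<^sub>\<infinity>y. f (x, y))"
      by (rule infsum_cmult_right) (use Fs in auto)
    also have "\<dots> = K\<^sup>2 * infsum f (UNIV \<times> UNIV)"
      using infsum_Sigma_banach[OF fs] by simp
    finally have "ell2_norm w \<le> sqrt (K\<^sup>2 * infsum f (UNIV \<times> UNIV))"
      by (simp add: ell2_norm_def h_def[abs_def])
    also have "\<dots> = K * ell2_norm u"
      using K by (simp add: real_sqrt_mult ell2_norm_def f_def[abs_def])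
    finally have norm: "ell2_norm w \<le> K * ell2_norm u" .
    have "w (x, y) = 0" if "(x, y) \<notin> X \<times> Y" for x y
    proof (cases "y \<in> Y")
      case True
      then have "(\<lambda>y. u (x, y)) = (\<lambda>y. 0 * u (x, y))" using that u by (auto simp: ell2_def)
      then have "B (\<lambda>y. u (x, y)) = (\<lambda>y. 0 * B (\<lambda>y. u (x, y)) y)"
        using scale[OF slice[OF u, of x], of 0] by simp
      then show ?thesis by (simp add: w_def)
    next
      case False
      then show ?thesis using B[OF slice[OF u, of x]] by (simp add: w_def ell2_def)
    qed
    then have "w \<in> ell2 (X \<times> Y)" using hs by (auto simp: ell2_def h_def[abs_def])
    with norm show ?thesis by (simp add: w_def)
  qed
  show ?thesis
    unfolding bounded_op_def
  proof (intro conjI ballI allI)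
    show "\<exists>K\<ge>0. \<forall>\<xi>\<in>ell2 (X \<times> Y). ell2_norm (\<lambda>(x, y). B (\<lambda>y'. \<xi> (x, y')) y) \<le> K * ell2_norm \<xi>"
      using main K(1) by blast
  qed (use main in \<open>auto simp: fun_eq_iff add scale slice\<close>)
qed

lemma bounded_op_swap:
  fixes X :: "'a set" and Y :: "'b set"
  assumes "bounded_op (Y \<times> X) T"
  shows "bounded_op (X \<times> Y) (\<lambda>u (x, y). T (\<lambda>(y', x'). u (x', y')) (y, x))"
proof -
  have mem: "(\<lambda>(y, x). u (x, y)) \<in> ell2 (Q \<times> P)" and norm: "ell2_norm (\<lambda>(y, x). u (x, y)) = ell2_norm u"
    if "u \<in> ell2 (P \<times> Q)" for u :: "'c \<times> 'd \<Rightarrow> complex" and P Q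
  proof -
    have bij: "bij_betw prod.swap UNIV UNIV" by simp
    have eq: "(\<lambda>(y, x). u (x, y)) = (\<lambda>p. u (prod.swap p))"
      by (auto simp: fun_eq_iff)
    show "(\<lambda>(y, x). u (x, y)) \<in> ell2 (Q \<times> P)"
      using that summable_on_reindex_bij_betw[OF bij, of "\<lambda>p. (cmod (u p))\<^sup>2"]
      unfolding ell2_def eq by auto
    show "ell2_norm (\<lambda>(y, x). u (x, y)) = ell2_norm u"
      using infsum_reindex_bij_betw[OF bij, of "\<lambda>p. (cmod (u p))\<^sup>2"]
      unfolding ell2_norm_def eq by simp
  qed
  obtain K where K: "K \<ge> 0" "\<forall>\<xi>\<in>ell2 (Y \<times> X). ell2_norm (T \<xi>) \<le> K * ell2_norm \<xi>"
    and T: "\<forall>\<xi>\<in>ell2 (Y \<times> X). T \<xi> \<in> ell2 (Y \<times> X)"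
    and add: "\<And>\<xi> \<eta>. \<xi> \<in> ell2 (Y \<times> X) \<Longrightarrow> \<eta> \<in> ell2 (Y \<times> X) \<Longrightarrow>
      T (\<lambda>x. \<xi> x + \<eta> x) = (\<lambda>x. T \<xi> x + T \<eta> x)"
    and scale: "\<And>\<xi> c. \<xi> \<in> ell2 (Y \<times> X) \<Longrightarrow> T (\<lambda>x. c * \<xi> x) = (\<lambda>x. c * T \<xi> x)"
    using assms by (auto simp: bounded_op_def)
  show ?thesis
    unfolding bounded_op_def
  proof (intro conjI ballI allI)
    fix u :: "'a \<times> 'b \<Rightarrow> complex" assume u: "u \<in> ell2 (X \<times> Y)"
    show "(\<lambda>(x, y). T (\<lambda>(y', x'). u (x', y')) (y, x)) \<in> ell2 (X \<times> Y)"
      using mem[OF T[rule_format, OF mem[OF u]]] .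
    show "(\<lambda>(x, y). T (\<lambda>(y', x'). c * u (x', y')) (y, x)) =
        (\<lambda>p. c * (\<lambda>(x, y). T (\<lambda>(y', x'). u (x', y')) (y, x)) p)" for c
      using scale[OF mem[OF u], of c] by (simp add: case_prod_unfold)
    fix v :: "'a \<times> 'b \<Rightarrow> complex" assume v: "v \<in> ell2 (X \<times> Y)"
    show "(\<lambda>(x, y). T (\<lambda>(y', x'). u (x', y') + v (x', y')) (y, x)) =
        (\<lambda>p. (\<lambda>(x, y). T (\<lambda>(y', x'). u (x', y')) (y, x)) p +
             (\<lambda>(x, y). T (\<lambda>(y', x'). v (x', y')) (y, x)) p)"
      using add[OF mem[OF u] mem[OF v]] by (simp add: case_prod_unfold)
  next
    have "ell2_norm (\<lambda>(x, y). T (\<lambda>(y', x'). u (x', y')) (y, x)) \<le> K * ell2_norm u"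
      if u: "u \<in> ell2 (X \<times> Y)" for u :: "'a \<times> 'b \<Rightarrow> complex"
      using norm[OF T[rule_format, OF mem[OF u]]] K(2)[rule_format, OF mem[OF u]] norm[OF u] by simp
    then show "\<exists>K\<ge>0. \<forall>u\<in>ell2 (X \<times> Y).
        ell2_norm (\<lambda>(x, y). T (\<lambda>(y', x'). u (x', y')) (y, x)) \<le> K * ell2_norm u"
      using K(1) by blast
  qed
qed

lemma bounded_op_tensor_op:
  assumes "bounded_op X A" "bounded_op Y B"
  shows "bounded_op (X \<times> Y) (A \<otimes>\<^sub>o B)"
  using bounded_op_comp[OF bounded_op_swap[OF bounded_op_leg[OF assms(1)]] bounded_op_leg[OF assms(2)]]
  by (simp add: tensor_op_def)

end

theory Submission
  imports Defs
begin

text \<open>An edge of the glued graph is an edge of \<open>G1\<close>, an edge of the copy of \<open>G2\<close> attached at \<open>e1\<close>, or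
  an edge of a copy attached at some \<open>x \<noteq> e1\<close>. Accordingly its adjacency matrix is a sum of three
  kernels (\<open>adjacency_glue\<close>), and each of them moves a single coordinate of a vertex \<open>(x, y, z)\<close>.
  The edges of \<open>G1\<close> join the vertices \<open>(x, e2, f2)\<close> and move \<open>x\<close>; the copy at \<open>e1\<close> consists of the
  \<open>(e1, y, f2)\<close>, and its edges move \<open>y\<close>; the copy at \<open>x \<noteq> e1\<close> consists of the \<open>(x, e2, z)\<close>, and
  its edges move \<open>z\<close>. Summing a vector against one of the kernels is therefore the adjacency operator of
  \<open>G1\<close> or \<open>G2\<close> applied to a slice of the vector (\<open>adj_op_along_injection\<close>), and these slices are
  exactly what the elementary tensors in \<open>S1\<close> and \<open>S2\<close> compute in coordinates.

  In the tensor \<open>P \<otimes> a2 \<otimes> 1\<close>, with \<open>P\<close> the projection onto \<open>e1\<close>, the operator \<open>a2\<close> acts for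
  every value of \<open>z\<close>, and not only for \<open>z = f2\<close>; this is harmless because a vector supported on the glued vertices has zero slices there.
  For the same reason all three tensors leave the \<open>\<ell>\<^sup>2\<close> space of the glued graph invariant
  (\<open>summands_vanish_outside\<close>).

  For boundedness, the row sums of the adjacency matrix of a uniformly locally finite graph are bounded
  by a common \<open>d\<close>; the matrix is symmetric, so the Schur test bounds the operator by \<open>d\<close>
  (\<open>bounded_op_adj_op\<close>). Tensor products with projections and identities stay bounded, and
  boundedness passes to the invariant subspace.\<close>

section \<open>The adjacency matrix\<close>

lemma adjacency_commute: "adjacency G x y = adjacency G y x"
  by (simp add: adjacency_def insert_commute)

lemma adjacency_outside:
  assumes "wf_ugraph G" "x \<notin> verts G \<or> y \<notin> verts G"
  shows "adjacency G x y = 0"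
proof -
  have "{\<epsilon> \<in> edges G. ends G \<epsilon> = {x, y}} = {}"
    using assms by (fastforce simp: wf_ugraph_def)
  then show ?thesis unfolding adjacency_def by (simp only: card.empty)
qed

lemma finite_edges_at:
  assumes "wf_ugraph G" "uniformly_locally_finite G"
  shows "finite {\<epsilon>\<in>edges G. x \<in> ends G \<epsilon>}"
proof (cases "x \<in> verts G")
  case False
  then have "{\<epsilon>\<in>edges G. x \<in> ends G \<epsilon>} = {}"
    using assms(1) by (fastforce simp: wf_ugraph_def)
  then show ?thesis by (simp only: finite.emptyI)
qed (use assms(2) in \<open>auto simp: uniformly_locally_finite_def\<close>)

lemma finite_edges_between:
  assumes "wf_ugraph G" "uniformly_locally_finite G"
  shows "finite {\<epsilon>\<in>edges G. ends G \<epsilon> = {x, y}}"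
  by (rule finite_subset[OF _ finite_edges_at[OF assms, of x]]) auto

text \<open>A vertex has finitely many incident edges, and each of them has at most two ends.\<close>

lemma finite_neighbours:
  assumes "wf_ugraph G" "uniformly_locally_finite G"
  shows "finite {y. adjacency G x y \<noteq> 0}"
proof (rule finite_subset)
  show "{y. adjacency G x y \<noteq> 0} \<subseteq> (\<Union>\<epsilon>\<in>{\<epsilon>\<in>edges G. x \<in> ends G \<epsilon>}. ends G \<epsilon>)"
    by (auto simp: adjacency_def card_gt_0_iff)
  show "finite (\<Union>\<epsilon>\<in>{\<epsilon>\<in>edges G. x \<in> ends G \<epsilon>}. ends G \<epsilon>)"
    using assms(1) by (intro finite_UN_I finite_edges_at[OF assms]) (auto simp: wf_ugraph_def)
qed

text \<open>The edges joining \<open>x\<close> to different vertices are different edges at \<open>x\<close>, so a row sum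
  is at most the degree.\<close>

lemma adjacency_row_sums_bounded:
  assumes "wf_ugraph G" "uniformly_locally_finite G"
  obtains d where "\<And>x N. finite N \<Longrightarrow> (\<Sum>y\<in>N. adjacency G x y) \<le> d"
proof -
  obtain d where d: "\<And>x. x \<in> verts G \<Longrightarrow> card {\<epsilon>\<in>edges G. x \<in> ends G \<epsilon>} \<le> d"
    using assms(2) by (auto simp: uniformly_locally_finite_def)
  have "(\<Sum>y\<in>N. adjacency G x y) \<le> d" if N: "finite N" for x N
  proof (cases "x \<in> verts G")
    case True
    have "(\<Sum>y\<in>N. adjacency G x y) = card (\<Union>y\<in>N. {\<epsilon>\<in>edges G. ends G \<epsilon> = {x, y}})"
      unfolding adjacency_def
      by (rule card_UN_disjoint[symmetric])
        (use N finite_edges_between[OF assms] in \<open>auto simp: doubleton_eq_iff\<close>)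
    also have "\<dots> \<le> card {\<epsilon>\<in>edges G. x \<in> ends G \<epsilon>}"
      by (rule card_mono[OF finite_edges_at[OF assms]]) auto
    finally show ?thesis using d[OF True] by simp
  qed (simp add: adjacency_outside[OF assms(1)])
  then show thesis by (rule that)
qed

section \<open>The adjacency operator is bounded\<close>

lemma adj_op_outside:
  assumes "wf_ugraph G" "x \<notin> verts G"
  shows "adj_op G \<xi> x = 0"
  by (simp add: adj_op_def adjacency_outside assms)

lemma adj_op_zero: "adj_op G (\<lambda>_. 0) = (\<lambda>_. 0)"
  by (simp add: adj_op_def)

text \<open>Enlarging the support of the row to any finite \<open>N\<close> allows one set \<open>N\<close> to serve finitely many
  rows at once, as the Schur test below requires.\<close>

lemma adj_op_finite_sum:
  assumes "wf_ugraph G" "finite N" "{y. adjacency G x y \<noteq> 0} \<subseteq> N"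
  shows "adj_op G \<xi> x = (\<Sum>y\<in>N. of_nat (adjacency G x y) * \<xi> y)"
proof -
  have "adj_op G \<xi> x = (\<Sum>\<^sub>\<infinity>y\<in>N. of_nat (adjacency G x y) * \<xi> y)"
    unfolding adj_op_def
    by (rule infsum_cong_neutral) (use assms adjacency_outside[OF assms(1)] in auto)
  then show ?thesis using assms by simp
qed

text \<open>The Cauchy-Schwarz inequality, after the weight is split as \<open>w = sqrt w * sqrt w\<close>.\<close>

lemma norm_weighted_sum_squared_le:
  fixes w :: "'a \<Rightarrow> nat" and \<xi> :: "'a \<Rightarrow> complex"
  shows "(cmod (\<Sum>y\<in>N. of_nat (w y) * \<xi> y))\<^sup>2 \<le> real (\<Sum>y\<in>N. w y) * (\<Sum>y\<in>N. w y * (cmod (\<xi> y))\<^sup>2)"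
proof -
  have "cmod (\<Sum>y\<in>N. of_nat (w y) * \<xi> y) \<le> (\<Sum>y\<in>N. sqrt (w y) * (sqrt (w y) * cmod (\<xi> y)))"
    by (rule order_trans[OF norm_sum]) (simp add: norm_mult flip: mult.assoc)
  then have "(cmod (\<Sum>y\<in>N. of_nat (w y) * \<xi> y))\<^sup>2 \<le> (\<Sum>y\<in>N. sqrt (w y) * (sqrt (w y) * cmod (\<xi> y)))\<^sup>2"
    by (rule power_mono) simp
  also have "\<dots> \<le> (\<Sum>y\<in>N. (sqrt (w y))\<^sup>2) * (\<Sum>y\<in>N. (sqrt (w y) * cmod (\<xi> y))\<^sup>2)"
    by (rule Cauchy_Schwarz_ineq_sum)
  finally show ?thesis by (simp add: power_mult_distrib)
qed

text \<open>The Schur test, run on finite sets of rows so that the double sum may be exchanged freely: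
  Cauchy-Schwarz costs one factor \<open>d\<close> from the row sums, and the exchange a second one from the
  column sums, which are row sums by symmetry.\<close>

lemma bounded_op_adj_op:
  assumes "wf_ugraph G" "uniformly_locally_finite G"
  shows "bounded_op (verts G) (adj_op G)"
proof -
  obtain d where d: "\<And>x N. finite N \<Longrightarrow> (\<Sum>y\<in>N. adjacency G x y) \<le> d"
    using adjacency_row_sums_bounded[OF assms] by blast
  have fin: "(\<Sum>x\<in>F. (cmod (adj_op G \<xi> x))\<^sup>2) \<le> (real d)\<^sup>2 * (\<Sum>\<^sub>\<infinity>y. (cmod (\<xi> y))\<^sup>2)"
    if F: "finite F" and \<xi>: "\<xi> \<in> ell2 (verts G)" for F \<xi>
  proof -
    define N where "N = (\<Union>x\<in>F. {y. adjacency G x y \<noteq> 0})"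
    have N: "finite N" using F finite_neighbours[OF assms] by (simp add: N_def)
    have "(cmod (adj_op G \<xi> x))\<^sup>2 \<le> d * (\<Sum>y\<in>N. adjacency G x y * (cmod (\<xi> y))\<^sup>2)" if "x \<in> F" for x
    proof -
      have "adj_op G \<xi> x = (\<Sum>y\<in>N. of_nat (adjacency G x y) * \<xi> y)"
        by (rule adj_op_finite_sum[OF assms(1) N]) (use that in \<open>auto simp: N_def\<close>)
      then have "(cmod (adj_op G \<xi> x))\<^sup>2 \<le>
          real (\<Sum>y\<in>N. adjacency G x y) * (\<Sum>y\<in>N. adjacency G x y * (cmod (\<xi> y))\<^sup>2)"
        by (simp only: norm_weighted_sum_squared_le)
      also have "\<dots> \<le> d * (\<Sum>y\<in>N. adjacency G x y * (cmod (\<xi> y))\<^sup>2)"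
        by (intro mult_right_mono sum_nonneg) (use d[OF N] in \<open>auto simp del: of_nat_sum\<close>)
      finally show ?thesis .
    qed
    then have "(\<Sum>x\<in>F. (cmod (adj_op G \<xi> x))\<^sup>2) \<le>
        (\<Sum>x\<in>F. d * (\<Sum>y\<in>N. adjacency G x y * (cmod (\<xi> y))\<^sup>2))"
      by (rule sum_mono)
    also have "\<dots> = d * (\<Sum>x\<in>F. \<Sum>y\<in>N. adjacency G x y * (cmod (\<xi> y))\<^sup>2)"
      by (simp add: sum_distrib_left)
    also have "\<dots> = d * (\<Sum>y\<in>N. real (\<Sum>x\<in>F. adjacency G y x) * (cmod (\<xi> y))\<^sup>2)"
      by (subst sum.swap) (simp add: sum_distrib_right adjacency_commute[of G])
    also have "\<dots> \<le> d * (\<Sum>y\<in>N. real d * (cmod (\<xi> y))\<^sup>2)"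
      by (intro mult_left_mono sum_mono mult_right_mono) (use d[OF F] in \<open>auto simp del: of_nat_sum\<close>)
    also have "\<dots> = (real d)\<^sup>2 * (\<Sum>y\<in>N. (cmod (\<xi> y))\<^sup>2)"
      by (simp add: sum_distrib_left power2_eq_square mult.assoc)
    also have "\<dots> \<le> (real d)\<^sup>2 * (\<Sum>\<^sub>\<infinity>y. (cmod (\<xi> y))\<^sup>2)"
      by (intro mult_left_mono finite_sum_le_infsum N) (use \<xi> in \<open>auto simp: ell2_def\<close>)
    finally show ?thesis .
  qed
  have summable: "(\<lambda>x. (cmod (adj_op G \<xi> x))\<^sup>2) summable_on UNIV" if "\<xi> \<in> ell2 (verts G)" for \<xi>
    by (rule nonneg_bdd_above_summable_on) (use fin[OF _ that] in \<open>auto intro!: bdd_aboveI\<close>)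
  have norm: "ell2_norm (adj_op G \<xi>) \<le> real d * ell2_norm \<xi>" if "\<xi> \<in> ell2 (verts G)" for \<xi>
  proof -
    have "(\<Sum>\<^sub>\<infinity>x. (cmod (adj_op G \<xi> x))\<^sup>2) \<le> (real d)\<^sup>2 * (\<Sum>\<^sub>\<infinity>y. (cmod (\<xi> y))\<^sup>2)"
      by (rule infsum_le_finite_sums[OF summable[OF that]]) (use fin[OF _ that] in auto)
    then have "ell2_norm (adj_op G \<xi>) \<le> sqrt ((real d)\<^sup>2 * (\<Sum>\<^sub>\<infinity>y. (cmod (\<xi> y))\<^sup>2))"
      by (simp add: ell2_norm_def)
    then show ?thesis by (simp add: real_sqrt_mult ell2_norm_def)
  qed
  have sum: "adj_op G \<xi> x = (\<Sum>y\<in>{y. adjacency G x y \<noteq> 0}. of_nat (adjacency G x y) * \<xi> y)" for \<xi> x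
    by (rule adj_op_finite_sum[OF assms(1) finite_neighbours[OF assms]]) simp
  show ?thesis
    unfolding bounded_op_def
  proof (intro conjI ballI allI)
    show "\<exists>K\<ge>0. \<forall>\<xi>\<in>ell2 (verts G). ell2_norm (adj_op G \<xi>) \<le> K * ell2_norm \<xi>"
      using norm by (intro exI[of _ "real d"]) auto
    show "adj_op G \<xi> \<in> ell2 (verts G)" if "\<xi> \<in> ell2 (verts G)" for \<xi>
      using summable[OF that] adj_op_outside[OF assms(1)] by (simp add: ell2_def)
    show "adj_op G (\<lambda>x. \<xi> x + \<eta> x) = (\<lambda>x. adj_op G \<xi> x + adj_op G \<eta> x)" for \<xi> \<eta>
      by (simp add: sum fun_eq_iff distrib_left sum.distrib)
    show "adj_op G (\<lambda>x. c * \<xi> x) = (\<lambda>x. c * adj_op G \<xi> x)" for \<xi> c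
      by (simp add: sum fun_eq_iff sum_distrib_left mult.left_commute)
  qed
qed

section \<open>Coordinate projections, sums and invariant subspaces\<close>

lemma bounded_op_id: "bounded_op X id"
  by (auto simp: bounded_op_def intro!: exI[of _ 1])

text \<open>The common source of the boundedness of \<open>P\<close> and \<open>1 - P\<close> for a vertex projection \<open>P\<close>: both
  only delete coordinates.\<close>

lemma bounded_op_mask:
  "bounded_op X (\<lambda>\<xi> y. if P y then \<xi> y else 0)"
proof -
  have s: "(\<lambda>y. (cmod (if P y then \<xi> y else 0))\<^sup>2) summable_on UNIV"
    and n: "ell2_norm (\<lambda>y. if P y then \<xi> y else 0) \<le> 1 * ell2_norm \<xi>"
    if "\<xi> \<in> ell2 X" for \<xi>
  proof -
    have \<xi>: "(\<lambda>y. (cmod (\<xi> y))\<^sup>2) summable_on UNIV" using that by (simp add: ell2_def)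
    show s: "(\<lambda>y. (cmod (if P y then \<xi> y else 0))\<^sup>2) summable_on UNIV"
      by (rule summable_on_comparison_test[OF \<xi>]) auto
    show "ell2_norm (\<lambda>y. if P y then \<xi> y else 0) \<le> 1 * ell2_norm \<xi>"
      unfolding ell2_norm_def mult_1 by (intro real_sqrt_le_mono infsum_mono s \<xi>) auto
  qed
  have "\<exists>K\<ge>0. \<forall>\<xi>\<in>ell2 X. ell2_norm (\<lambda>y. if P y then \<xi> y else 0) \<le> K * ell2_norm \<xi>"
    using n by (intro exI[of _ 1]) auto
  then show ?thesis using s by (auto simp: bounded_op_def ell2_def fun_eq_iff)
qed

lemma vertex_proj_perp_apply: "(id - vertex_proj x) \<xi> = (\<lambda>y. if y \<noteq> x then \<xi> y else 0)"
  by (auto simp: vertex_proj_apply fun_eq_iff)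

lemma bounded_op_vertex_proj: "bounded_op X (vertex_proj x)"
proof -
  have "vertex_proj x = (\<lambda>\<xi> y. if y = x then \<xi> y else 0)"
    by (auto simp: vertex_proj_apply fun_eq_iff)
  then show ?thesis using bounded_op_mask[of X "\<lambda>y. y = x"] by simp
qed

lemma bounded_op_vertex_proj_perp: "bounded_op X (id - vertex_proj x)"
proof -
  have "id - vertex_proj x = (\<lambda>\<xi> y. if y \<noteq> x then \<xi> y else 0)"
    by (rule ext) (rule vertex_proj_perp_apply)
  then show ?thesis using bounded_op_mask[of X "\<lambda>y. y \<noteq> x"] by simp
qed

text \<open>The parallelogram bound \<open>|a + b|^2 \<le> 2 (|a|^2 + |b|^2)\<close>, summed over coordinates. It takes the
  place of the triangle inequality: to bound a sum of two operators, any constant will do.\<close>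

lemma ell2_norm_add_squared_le:
  assumes "(\<lambda>x. (cmod (\<xi> x))\<^sup>2) summable_on UNIV" "(\<lambda>x. (cmod (\<eta> x))\<^sup>2) summable_on UNIV"
  shows "(\<lambda>x. (cmod (\<xi> x + \<eta> x))\<^sup>2) summable_on UNIV"
    and "(ell2_norm (\<lambda>x. \<xi> x + \<eta> x))\<^sup>2 \<le> 2 * ((ell2_norm \<xi>)\<^sup>2 + (ell2_norm \<eta>)\<^sup>2)"
proof -
  have le: "(cmod (\<xi> x + \<eta> x))\<^sup>2 \<le> 2 * ((cmod (\<xi> x))\<^sup>2 + (cmod (\<eta> x))\<^sup>2)" for x
  proof -
    have "(cmod (\<xi> x + \<eta> x))\<^sup>2 \<le> (cmod (\<xi> x) + cmod (\<eta> x))\<^sup>2"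
      by (intro power_mono norm_triangle_ineq) simp
    also have "\<dots> \<le> 2 * ((cmod (\<xi> x))\<^sup>2 + (cmod (\<eta> x))\<^sup>2)"
      using sum_squares_bound[of "cmod (\<xi> x)" "cmod (\<eta> x)"] by (simp add: power2_sum)
    finally show ?thesis .
  qed
  have s: "(\<lambda>x. (cmod (\<xi> x))\<^sup>2 + (cmod (\<eta> x))\<^sup>2) summable_on UNIV"
    by (rule summable_on_add[OF assms])
  then have s2: "(\<lambda>x. 2 * ((cmod (\<xi> x))\<^sup>2 + (cmod (\<eta> x))\<^sup>2)) summable_on UNIV"
    by (rule summable_on_cmult_right)
  show t: "(\<lambda>x. (cmod (\<xi> x + \<eta> x))\<^sup>2) summable_on UNIV"
    by (rule summable_on_comparison_test[OF s2 le]) auto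
  have "(\<Sum>\<^sub>\<infinity>x. (cmod (\<xi> x + \<eta> x))\<^sup>2) \<le> (\<Sum>\<^sub>\<infinity>x. 2 * ((cmod (\<xi> x))\<^sup>2 + (cmod (\<eta> x))\<^sup>2))"
    by (rule infsum_mono[OF t s2 le])
  also have "\<dots> = 2 * ((\<Sum>\<^sub>\<infinity>x. (cmod (\<xi> x))\<^sup>2) + (\<Sum>\<^sub>\<infinity>x. (cmod (\<eta> x))\<^sup>2))"
    by (simp only: infsum_cmult_right' infsum_add[OF assms])
  finally show "(ell2_norm (\<lambda>x. \<xi> x + \<eta> x))\<^sup>2 \<le> 2 * ((ell2_norm \<xi>)\<^sup>2 + (ell2_norm \<eta>)\<^sup>2)"
    by (simp add: ell2_norm_def infsum_nonneg)
qed

lemma bounded_op_add: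
  assumes "bounded_op X S" "bounded_op X T"
  shows "bounded_op X (S + T)"
proof -
  obtain K L where K: "K \<ge> 0" "\<forall>\<xi>\<in>ell2 X. ell2_norm (S \<xi>) \<le> K * ell2_norm \<xi>"
    and L: "L \<ge> 0" "\<forall>\<xi>\<in>ell2 X. ell2_norm (T \<xi>) \<le> L * ell2_norm \<xi>"
    using assms by (auto simp: bounded_op_def)
  have mem: "S \<xi> \<in> ell2 X" "T \<xi> \<in> ell2 X" if "\<xi> \<in> ell2 X" for \<xi>
    using assms that by (auto simp: bounded_op_def)
  have nn: "0 \<le> ell2_norm \<xi>" for \<xi> :: "'a \<Rightarrow> complex"
    by (simp add: ell2_norm_def infsum_nonneg)
  define M where "M = sqrt (2 * (K\<^sup>2 + L\<^sup>2))"
  have norm: "ell2_norm ((S + T) \<xi>) \<le> M * ell2_norm \<xi>" if \<xi>: "\<xi> \<in> ell2 X" for \<xi>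
  proof (rule power2_le_imp_le)
    have "(ell2_norm ((S + T) \<xi>))\<^sup>2 \<le> 2 * ((ell2_norm (S \<xi>))\<^sup>2 + (ell2_norm (T \<xi>))\<^sup>2)"
      using ell2_norm_add_squared_le(2)[of "S \<xi>" "T \<xi>"] mem[OF \<xi>] by (simp add: ell2_def plus_fun_def)
    also have "\<dots> \<le> 2 * ((K * ell2_norm \<xi>)\<^sup>2 + (L * ell2_norm \<xi>)\<^sup>2)"
      using K L \<xi> nn by (intro mult_left_mono add_mono power_mono) auto
    also have "\<dots> = (M * ell2_norm \<xi>)\<^sup>2"
      by (simp add: M_def power_mult_distrib algebra_simps)
    finally show "(ell2_norm ((S + T) \<xi>))\<^sup>2 \<le> (M * ell2_norm \<xi>)\<^sup>2" .
    show "0 \<le> M * ell2_norm \<xi>" by (simp add: M_def nn)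
  qed
  have mem': "(S + T) \<xi> \<in> ell2 X" if "\<xi> \<in> ell2 X" for \<xi>
    using ell2_norm_add_squared_le(1)[of "S \<xi>" "T \<xi>"] mem[OF that] by (simp add: ell2_def plus_fun_def)
  have "\<exists>K\<ge>0. \<forall>\<xi>\<in>ell2 X. ell2_norm ((S + T) \<xi>) \<le> K * ell2_norm \<xi>"
    using norm by (intro exI[of _ M]) (auto simp: M_def)
  with mem' show ?thesis
    using assms unfolding bounded_op_def by (auto simp: fun_eq_iff algebra_simps)
qed

lemma ell2_mono: "X \<subseteq> Y \<Longrightarrow> ell2 X \<subseteq> ell2 Y"
  by (auto simp: ell2_def)

text \<open>This carries boundedness from the full tensor product down to the subspace of vectors supported on
  the glued vertices.\<close>

lemma bounded_op_invariant_subset: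
  assumes "bounded_op Y T" "X \<subseteq> Y"
    and "\<And>\<xi> x. \<xi> \<in> ell2 X \<Longrightarrow> x \<notin> X \<Longrightarrow> T \<xi> x = 0"
  shows "bounded_op X T"
proof -
  have sub: "\<xi> \<in> ell2 Y" if "\<xi> \<in> ell2 X" for \<xi>
    using ell2_mono[OF assms(2)] that by blast
  have "T \<xi> \<in> ell2 X" if "\<xi> \<in> ell2 X" for \<xi>
  proof -
    have "T \<xi> \<in> ell2 Y" using assms(1) sub[OF that] by (simp add: bounded_op_def)
    then show ?thesis using assms(3)[OF that] by (simp add: ell2_def)
  qed
  moreover obtain K where "K \<ge> 0" "\<forall>\<xi>\<in>ell2 Y. ell2_norm (T \<xi>) \<le> K * ell2_norm \<xi>"
    using assms(1) by (auto simp: bounded_op_def)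
  then have "\<exists>K\<ge>0. \<forall>\<xi>\<in>ell2 X. ell2_norm (T \<xi>) \<le> K * ell2_norm \<xi>" using sub by blast
  ultimately show ?thesis using assms(1) sub unfolding bounded_op_def by simp
qed

section \<open>The three summands in coordinates\<close>

lemma base_summand_apply:
  "(adj_op G1 \<otimes>\<^sub>o vertex_proj e2 \<otimes>\<^sub>o vertex_proj f2) \<xi> (x, y, z) =
     (if y = e2 \<and> z = f2 then adj_op G1 (\<lambda>x'. \<xi> (x', e2, f2)) x else 0)"
  by (cases "y = e2"; cases "z = f2") (simp_all add: tensor_op_def vertex_proj_apply adj_op_zero)

lemma root_copy_summand_apply:
  "(vertex_proj e1 \<otimes>\<^sub>o adj_op G2 \<otimes>\<^sub>o id) \<xi> (x, y, z) =
     (if x = e1 then adj_op G2 (\<lambda>y'. \<xi> (e1, y', z)) y else 0)"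
  by (auto simp: tensor_op_def vertex_proj_apply)

lemma other_copies_summand_apply:
  "((id - vertex_proj e1) \<otimes>\<^sub>o id \<otimes>\<^sub>o adj_op G2) \<xi> (x, y, z) =
     (if x \<noteq> e1 then adj_op G2 (\<lambda>z'. \<xi> (x, y, z')) z else 0)"
  unfolding tensor_op_def vertex_proj_perp_apply by auto

section \<open>The adjacency matrix of the glued graph\<close>

lemma mem_verts_glue:
  "(x, y, z) \<in> verts (glue G1 e1 G2 e2 f2) \<longleftrightarrow>
     x = e1 \<and> y \<in> verts G2 \<and> z = f2 \<or> x \<in> verts G1 \<and> x \<noteq> e1 \<and> y = e2 \<and> z \<in> verts G2"
  by (auto simp: glue_def)

lemma ends_glue:
  "ends (glue G1 e1 G2 e2 f2) (Inl \<alpha>) = (\<lambda>x. (x, e2, f2)) ` ends G1 \<alpha>"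
  "ends (glue G1 e1 G2 e2 f2) (Inr (x, \<beta>)) = copy_vertex e1 e2 f2 x ` ends G2 \<beta>"
  by (simp_all add: glue_def base_vertex_eq)

lemma inj_image_eq_doubleton:
  assumes "inj f"
  shows "f ` A = {p, q} \<longleftrightarrow> (\<exists>u v. A = {u, v} \<and> p = f u \<and> q = f v)"
proof
  assume *: "f ` A = {p, q}"
  then have "p \<in> f ` A" "q \<in> f ` A" by simp_all
  then obtain u v where "p = f u" "q = f v" by blast
  with * have "f ` A = f ` {u, v}" by simp
  then have "A = {u, v}" by (simp only: inj_image_eq_iff[OF assms])
  then show "\<exists>u v. A = {u, v} \<and> p = f u \<and> q = f v" using \<open>p = f u\<close> \<open>q = f v\<close> by blast
qed auto

text \<open>No two vertices of \<open>G2\<close> are identified within one copy, so an edge of a copy has the multiplicity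
  that it has in \<open>G2\<close>.\<close>

lemma inj_copy_vertex: "inj (copy_vertex e1 e2 f2 x)"
  by (auto simp: inj_def copy_vertex_def)

text \<open>The restriction to glued vertices makes the right-hand side short: \<open>x = x' = e1\<close> forces
  \<open>z = z' = f2\<close>, and \<open>x = x' \<noteq> e1\<close> forces \<open>y = y' = e2\<close>.\<close>

lemma adjacency_glue:
  assumes "wf_ugraph G1" "uniformly_locally_finite G1" "wf_ugraph G2" "uniformly_locally_finite G2"
    and "e1 \<in> verts G1"
    and p: "(x, y, z) \<in> verts (glue G1 e1 G2 e2 f2)"
    and q: "(x', y', z') \<in> verts (glue G1 e1 G2 e2 f2)"
  shows "adjacency (glue G1 e1 G2 e2 f2) (x, y, z) (x', y', z') =
     (if y = e2 \<and> z = f2 \<and> y' = e2 \<and> z' = f2 then adjacency G1 x x' else 0) +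
     (if x = e1 \<and> x' = e1 then adjacency G2 y y' else 0) +
     (if x \<noteq> e1 \<and> x' = x then adjacency G2 z z' else 0)"
proof -
  let ?G = "glue G1 e1 G2 e2 f2"
  \<comment> \<open>The edges of the glued graph between the two vertices, sorted by origin: \<open>A\<close> from \<open>G1\<close>,
    \<open>B\<close> from the copy at \<open>e1\<close>, \<open>C\<close> from the copy at another vertex.\<close>
  define A where "A = {\<alpha>\<in>edges G1. y = e2 \<and> z = f2 \<and> y' = e2 \<and> z' = f2 \<and> ends G1 \<alpha> = {x, x'}}"
  define B where "B = {\<beta>\<in>edges G2. x = e1 \<and> x' = e1 \<and> ends G2 \<beta> = {y, y'}}"
  define C where "C = {\<beta>\<in>edges G2. x \<noteq> e1 \<and> x' = x \<and> ends G2 \<beta> = {z, z'}}"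
  have x: "x \<in> verts G1" using p assms(5) by (auto simp: mem_verts_glue)
  have inl: "ends ?G (Inl \<alpha>) = {(x, y, z), (x', y', z')} \<longleftrightarrow>
      y = e2 \<and> z = f2 \<and> y' = e2 \<and> z' = f2 \<and> ends G1 \<alpha> = {x, x'}" for \<alpha>
    unfolding ends_glue by (subst inj_image_eq_doubleton) (auto simp: inj_def)
  have inr: "ends ?G (Inr (w, \<beta>)) = {(x, y, z), (x', y', z')} \<longleftrightarrow>
      w = x \<and> (x = e1 \<and> x' = e1 \<and> ends G2 \<beta> = {y, y'} \<or> x \<noteq> e1 \<and> x' = x \<and> ends G2 \<beta> = {z, z'})"
    for w \<beta>
    unfolding ends_glue inj_image_eq_doubleton[OF inj_copy_vertex]
    using p q by (auto simp: copy_vertex_def mem_verts_glue)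
  have "{\<epsilon>\<in>edges ?G. ends ?G \<epsilon> = {(x, y, z), (x', y', z')}} = A <+> ({x} \<times> (B \<union> C))"
  proof (rule set_eqI)
    fix \<epsilon>
    show "\<epsilon> \<in> {\<epsilon>\<in>edges ?G. ends ?G \<epsilon> = {(x, y, z), (x', y', z')}} \<longleftrightarrow> \<epsilon> \<in> A <+> ({x} \<times> (B \<union> C))"
    proof (cases \<epsilon>)
      case (Inl \<alpha>)
      then show ?thesis using inl[of \<alpha>] by (auto simp: A_def glue_def)
    next
      case (Inr b)
      then show ?thesis using inr[of "fst b" "snd b"] x
        by (cases b) (auto simp: B_def C_def glue_def)
    qed
  qed
  moreover have "finite A" "finite B" "finite C"
    unfolding A_def B_def C_def
    by (rule finite_subset[OF _ finite_edges_between[OF assms(1,2), of x x']]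
        finite_subset[OF _ finite_edges_between[OF assms(3,4), of y y']]
        finite_subset[OF _ finite_edges_between[OF assms(3,4), of z z']]; blast)+
  moreover have "B \<inter> C = {}" by (auto simp: B_def C_def)
  ultimately have "adjacency ?G (x, y, z) (x', y', z') = card A + card B + card C"
    by (simp add: adjacency_def card_Plus card_Un_disjoint)
  then show ?thesis by (auto simp: A_def B_def C_def adjacency_def)
qed

section \<open>The decomposition\<close>

text \<open>If \<open>j\<close> embeds the vertices of \<open>G\<close> in \<open>V\<close>, and the kernel \<open>k\<close> is the row \<open>x\<close> of
  the adjacency matrix transported along \<open>j\<close>, then summing \<open>\<xi>\<close> against \<open>k\<close> applies the
  adjacency operator to the slice of \<open>\<xi>\<close> along \<open>j\<close>.\<close>

lemma adj_op_along_injection: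
  assumes "wf_ugraph G" "uniformly_locally_finite G" "inj j"
    and "\<And>y. y \<in> verts G \<Longrightarrow> j y \<in> V"
    and "\<And>y. k (j y) = adjacency G x y"
    and "\<And>q. q \<in> V \<Longrightarrow> q \<notin> range j \<Longrightarrow> k q = 0"
  shows "((\<lambda>q. of_nat (k q) * \<xi> q) has_sum adj_op G (\<lambda>y. \<xi> (j y)) x) V"
proof -
  let ?N = "{y. adjacency G x y \<noteq> 0}"
  note N = finite_neighbours[OF assms(1,2), of x]
  have "((\<lambda>y. of_nat (adjacency G x y) * \<xi> (j y)) has_sum adj_op G (\<lambda>y. \<xi> (j y)) x) ?N"
    unfolding adj_op_finite_sum[OF assms(1) N order_refl] by (rule has_sum_finite[OF N])
  then have "((\<lambda>q. of_nat (k q) * \<xi> q) has_sum adj_op G (\<lambda>y. \<xi> (j y)) x) (j ` ?N)"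
    by (subst has_sum_reindex) (simp_all only: inj_on_subset[OF assms(3)] subset_UNIV o_def assms(5))
  moreover have "j ` ?N \<subseteq> V"
  proof (rule image_subsetI)
    fix y assume "y \<in> ?N"
    then have "y \<in> verts G" using adjacency_outside[OF assms(1), of x y] by auto
    then show "j y \<in> V" by (rule assms(4))
  qed
  moreover have "k q = 0" if "q \<in> V" "q \<notin> j ` ?N" for q
    using that assms(5,6) by (cases "q \<in> range j") auto
  ultimately show ?thesis
    by (subst has_sum_cong_neutral[where T = "j ` ?N" and g = "\<lambda>q. of_nat (k q) * \<xi> q"]) auto
qed

lemma adj_op_glue_apply:
  fixes G1 :: "('v, 'a) ugraph" and G2 :: "('w, 'b) ugraph"
  assumes "wf_ugraph G1" "uniformly_locally_finite G1" "wf_ugraph G2" "uniformly_locally_finite G2"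
    and "e1 \<in> verts G1" "e2 \<in> verts G2" "f2 \<in> verts G2"
    and p: "(x, y, z) \<in> verts (glue G1 e1 G2 e2 f2)"
  shows "adj_op (glue G1 e1 G2 e2 f2) \<xi> (x, y, z) =
     (if y = e2 \<and> z = f2 then adj_op G1 (\<lambda>x'. \<xi> (x', e2, f2)) x else 0) +
     (if x = e1 then adj_op G2 (\<lambda>y'. \<xi> (e1, y', z)) y else 0) +
     (if x \<noteq> e1 then adj_op G2 (\<lambda>z'. \<xi> (x, y, z')) z else 0)"
proof -
  let ?V = "verts (glue G1 e1 G2 e2 f2)"
  \<comment> \<open>The three kernels of \<open>adjacency_glue\<close>, as functions of the second vertex.\<close>
  define k1 where "k1 = (\<lambda>(x', y', z').
    if y = e2 \<and> z = f2 \<and> y' = e2 \<and> z' = f2 then adjacency G1 x x' else 0)"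
  define k2 where "k2 = (\<lambda>(x', y', z' :: 'w). if x = e1 \<and> x' = e1 then adjacency G2 y y' else 0)"
  define k3 where "k3 = (\<lambda>(x', y' :: 'w, z'). if x \<noteq> e1 \<and> x' = x then adjacency G2 z z' else 0)"
  have 1: "((\<lambda>q. of_nat (k1 q) * \<xi> q) has_sum
      (if y = e2 \<and> z = f2 then adj_op G1 (\<lambda>x'. \<xi> (x', e2, f2)) x else 0)) ?V"
  proof (cases "y = e2 \<and> z = f2")
    case True
    have "((\<lambda>q. of_nat (k1 q) * \<xi> q) has_sum adj_op G1 (\<lambda>x'. \<xi> (x', e2, f2)) x) ?V"
      by (rule adj_op_along_injection[where j = "\<lambda>x'. (x', e2, f2)", OF assms(1,2)])
        (use assms(5-7) True in \<open>auto simp: inj_def k1_def mem_verts_glue\<close>)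
    with True show ?thesis by simp
  next
    case False
    then have "k1 = (\<lambda>_. 0)" by (auto simp: k1_def)
    with False show ?thesis by auto
  qed
  have 2: "((\<lambda>q. of_nat (k2 q) * \<xi> q) has_sum
      (if x = e1 then adj_op G2 (\<lambda>y'. \<xi> (e1, y', z)) y else 0)) ?V"
  proof (cases "x = e1")
    case True
    have "((\<lambda>q. of_nat (k2 q) * \<xi> q) has_sum adj_op G2 (\<lambda>y'. \<xi> (e1, y', z)) y) ?V"
      by (rule adj_op_along_injection[where j = "\<lambda>y'. (e1, y', z)", OF assms(3,4)])
        (use p True in \<open>auto simp: inj_def k2_def mem_verts_glue\<close>)
    with True show ?thesis by simp
  qed (simp add: k2_def case_prod_unfold)
  have 3: "((\<lambda>q. of_nat (k3 q) * \<xi> q) has_sum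
      (if x \<noteq> e1 then adj_op G2 (\<lambda>z'. \<xi> (x, y, z')) z else 0)) ?V"
  proof (cases "x = e1")
    case False
    have "((\<lambda>q. of_nat (k3 q) * \<xi> q) has_sum adj_op G2 (\<lambda>z'. \<xi> (x, y, z')) z) ?V"
      by (rule adj_op_along_injection[where j = "\<lambda>z'. (x, y, z')", OF assms(3,4)])
        (use p False in \<open>auto simp: inj_def k3_def mem_verts_glue\<close>)
    with False show ?thesis by simp
  qed (simp add: k3_def case_prod_unfold)
  have "adj_op (glue G1 e1 G2 e2 f2) \<xi> (x, y, z) =
      (\<Sum>\<^sub>\<infinity>q\<in>?V. of_nat (k1 q) * \<xi> q + of_nat (k2 q) * \<xi> q + of_nat (k3 q) * \<xi> q)"
    unfolding adj_op_def
  proof (rule infsum_cong)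
    fix q assume q: "q \<in> ?V"
    have "adjacency (glue G1 e1 G2 e2 f2) (x, y, z) q = k1 q + k2 q + k3 q"
      using adjacency_glue[OF assms(1-5) p, of "fst q" "fst (snd q)" "snd (snd q)"] q
      by (simp add: k1_def k2_def k3_def case_prod_unfold)
    then show "of_nat (adjacency (glue G1 e1 G2 e2 f2) (x, y, z) q) * \<xi> q =
        of_nat (k1 q) * \<xi> q + of_nat (k2 q) * \<xi> q + of_nat (k3 q) * \<xi> q"
      by (simp add: distrib_right)
  qed
  then show ?thesis using infsumI[OF has_sum_add[OF has_sum_add[OF 1 2] 3]] by simp
qed

text \<open>Where the projections in a tensor do not already give zero, one of two reasons applies at a triple that
  is not a glued vertex: the coordinate that the adjacency
  operator moves is not a vertex there, or another coordinate is wrong, and then the whole slice along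
  the moved coordinate misses the support of \<open>\<xi>\<close>.\<close>

lemma summands_vanish_outside:
  assumes "wf_ugraph G1" "wf_ugraph G2" "e1 \<in> verts G1" "e2 \<in> verts G2" "f2 \<in> verts G2"
    and \<xi>: "\<xi> \<in> ell2 (verts (glue G1 e1 G2 e2 f2))"
    and p: "(x, y, z) \<notin> verts (glue G1 e1 G2 e2 f2)"
  shows "(adj_op G1 \<otimes>\<^sub>o vertex_proj e2 \<otimes>\<^sub>o vertex_proj f2) \<xi> (x, y, z) = 0"
    and "(vertex_proj e1 \<otimes>\<^sub>o adj_op G2 \<otimes>\<^sub>o id) \<xi> (x, y, z) = 0"
    and "((id - vertex_proj e1) \<otimes>\<^sub>o id \<otimes>\<^sub>o adj_op G2) \<xi> (x, y, z) = 0"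
proof -
  have 0: "\<xi> (x', y', z') = 0" if "(x', y', z') \<notin> verts (glue G1 e1 G2 e2 f2)" for x' y' z'
    using \<xi> that by (simp add: ell2_def)
  show "(adj_op G1 \<otimes>\<^sub>o vertex_proj e2 \<otimes>\<^sub>o vertex_proj f2) \<xi> (x, y, z) = 0"
    using p assms(3-5) adj_op_outside[OF assms(1)]
    by (auto simp: base_summand_apply mem_verts_glue)
  show "(vertex_proj e1 \<otimes>\<^sub>o adj_op G2 \<otimes>\<^sub>o id) \<xi> (x, y, z) = 0"
  proof (cases "x = e1 \<and> y \<in> verts G2")
    case True
    then have "(\<lambda>y'. \<xi> (e1, y', z)) = (\<lambda>_. 0)"
      using p by (auto simp: fun_eq_iff mem_verts_glue intro!: 0)
    then show ?thesis by (simp add: root_copy_summand_apply adj_op_zero)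
  qed (use adj_op_outside[OF assms(2)] in \<open>auto simp: root_copy_summand_apply\<close>)
  show "((id - vertex_proj e1) \<otimes>\<^sub>o id \<otimes>\<^sub>o adj_op G2) \<xi> (x, y, z) = 0"
  proof (cases "x \<noteq> e1 \<and> z \<in> verts G2")
    case True
    then have "(\<lambda>z'. \<xi> (x, y, z')) = (\<lambda>_. 0)"
      using p by (auto simp: fun_eq_iff mem_verts_glue intro!: 0)
    then show ?thesis by (simp add: other_copies_summand_apply adj_op_zero)
  qed (use adj_op_outside[OF assms(2)] in \<open>auto simp: other_copies_summand_apply\<close>)
qed

theorem theorem4p1:
  fixes G1 :: "('v, 'a) ugraph" and G2 :: "('w, 'b) ugraph"
    and e1 f1 :: 'v and e2 f2 :: 'w
  assumes "birooted_graph G1 e1 f1"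
    and "birooted_graph G2 e2 f2"
  defines "a1 \<equiv> adj_op G1"
    and "a2 \<equiv> adj_op G2"
    and "G \<equiv> glue G1 e1 G2 e2 f2"
    and "e \<equiv> glue_root e1 e2 f2"
  defines "S1 \<equiv> a1 \<otimes>\<^sub>o vertex_proj e2 \<otimes>\<^sub>o vertex_proj f2"
    and "S2 \<equiv> vertex_proj e1 \<otimes>\<^sub>o a2 \<otimes>\<^sub>o id + (id - vertex_proj e1) \<otimes>\<^sub>o id \<otimes>\<^sub>o a2"
  shows "ell2 (verts G) \<subseteq> ell2 (verts G1 \<times> verts G2 \<times> verts G2)
    \<and> bounded_op (verts G) S1
    \<and> bounded_op (verts G) S2
    \<and> (\<forall>\<xi>\<in>ell2 (verts G). adj_op G \<xi> = (S1 + S2) \<xi>)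
    \<and> e \<in> verts G
    \<and> delta e = delta e1 \<otimes>\<^sub>v delta e2 \<otimes>\<^sub>v delta f2"
proof -
  have G1: "wf_ugraph G1" "uniformly_locally_finite G1"
    and G2: "wf_ugraph G2" "uniformly_locally_finite G2"
    and roots: "e1 \<in> verts G1" "e2 \<in> verts G2" "f2 \<in> verts G2"
    using assms(1,2) by (auto simp: birooted_graph_def)
  let ?W = "verts G1 \<times> verts G2 \<times> verts G2"
  let ?T2 = "vertex_proj e1 \<otimes>\<^sub>o a2 \<otimes>\<^sub>o id"
  let ?T3 = "(id - vertex_proj e1) \<otimes>\<^sub>o id \<otimes>\<^sub>o a2"
  have sub: "verts G \<subseteq> ?W"
    using roots by (auto simp: G_def glue_def)
  have vanish: "S1 \<xi> p = 0" "?T2 \<xi> p = 0" "?T3 \<xi> p = 0"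
    if "\<xi> \<in> ell2 (verts G)" "p \<notin> verts G" for \<xi> p
    using summands_vanish_outside[OF G1(1) G2(1) roots, of \<xi> "fst p" "fst (snd p)" "snd (snd p)"] that
    by (simp_all add: S1_def a1_def a2_def G_def)
  have a1: "bounded_op (verts G1) a1" and a2: "bounded_op (verts G2) a2"
    using bounded_op_adj_op G1 G2 by (auto simp: a1_def a2_def)
  have "bounded_op ?W S1" "bounded_op ?W ?T2" "bounded_op ?W ?T3"
    unfolding S1_def
    by (intro bounded_op_tensor_op a1 a2 bounded_op_id bounded_op_vertex_proj
        bounded_op_vertex_proj_perp)+
  then have bounded: "bounded_op (verts G) S1" "bounded_op (verts G) ?T2" "bounded_op (verts G) ?T3"
    using bounded_op_invariant_subset[OF _ sub] vanish by blast+
  have "adj_op G \<xi> p = (S1 + S2) \<xi> p" if \<xi>: "\<xi> \<in> ell2 (verts G)" for \<xi> p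
  proof (cases "p \<in> verts G")
    case True
    obtain x y z where p: "p = (x, y, z)" by (cases p)
    show ?thesis
      using adj_op_glue_apply[OF G1 G2 roots, of x y z \<xi>] True
      by (simp add: p S1_def S2_def a1_def a2_def G_def base_summand_apply
          root_copy_summand_apply other_copies_summand_apply)
  next
    case False
    have "adj_op G \<xi> p = 0"
      using adj_op_outside[OF wf_glue[OF G1(1) G2(1) roots]] False by (simp add: G_def)
    then show ?thesis using vanish[OF \<xi> False] by (simp add: S2_def)
  qed
  moreover have "e \<in> verts G"
    using roots by (simp add: e_def glue_root_def base_vertex_eq G_def mem_verts_glue)
  moreover have "delta e = delta e1 \<otimes>\<^sub>v delta e2 \<otimes>\<^sub>v delta f2"
    by (auto simp: e_def glue_root_def base_vertex_eq delta_def tensor_vec_def fun_eq_iff)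
  ultimately show ?thesis
    using ell2_mono[OF sub] bounded(1) bounded_op_add[OF bounded(2,3)] by (auto simp: S2_def)
qed

end
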